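(* For $z\in\mathbb{C}\setminus\mathbb{N}$, we have $$\mathcal{H}(z)=\sum_{n=1}^{\infty}\frac{n|G_n|}{n-z}=\sum_{n=1}^{\infty}\frac{|G_n|}{1-z/n}.$$ The series converges locally uniformly on $\mathbb{C}\setminus\mathbb{N}$.
   Context: $\mathbb{N}=\{1,2,\ldots\}$. The Gregory coefficients $(G_n)_{n\ge0}$ are defined by $\frac{z}{\log(1+z)}=\sum_{n=0}^{\infty}G_nz^n$ for $|z|<1$. The Gregory function is the entire function $\mathcal{G}(z)=\int_0^1\binom{x}{z}\,dx=\frac{1}{\Gamma(z+1)}\int_0^1\frac{\Gamma(x+1)}{\Gamma(x-z+1)}\,dx$ (with $1/\Gamma$ entire). The completed Gregory transform is the meromorphic function $\mathcal{H}(z)=\frac{\pi z}{\sin\pi z}\mathcal{G}(z)$; its singularities at the nonpositive integers are removable, and it is regarded as a holomorphic function on $\mathbb{C}\setminus\mathbb{N}$. *)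

theory Defs
  imports "HOL-Complex_Analysis.Complex_Analysis"
begin

text \<open>
  At \<open>z = 0\<close> the quotient \<open>z / Ln (1 + z)\<close> is \<open>0 / 0 = 0\<close> in HOL, whereas the mathematical
  function takes its limit \<open>1\<close> there; hence the expansion is demanded on the punctured disc only,
  which still determines every coefficient (see \<open>gregory_coeff_sums\<close> and
  \<open>gregory_coeff_eqI\<close>).
\<close>

definition gregory_coeff :: "nat \<Rightarrow> real" where
  "gregory_coeff = (THE G. \<forall>z::complex. 0 < norm z \<and> norm z < 1 \<longrightarrow>
     (\<lambda>n. of_real (G n) * z ^ n) sums (z / Ln (1 + z)))"

lemma powser_punctured_unique:
  fixes a b :: "nat \<Rightarrow> complex"
  assumes a: "\<And>z. 0 < norm z \<Longrightarrow> norm z < 1 \<Longrightarrow> (\<lambda>n. a n * z ^ n) sums f z"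
      and b: "\<And>z. 0 < norm z \<Longrightarrow> norm z < 1 \<Longrightarrow> (\<lambda>n. b n * z ^ n) sums f z"
  shows "a = b"
proof -
  define d where "d n = a n - b n" for n
  have d: "(\<lambda>n. d n * z ^ n) sums 0" if "z \<noteq> 0" "norm z < 1" for z
    using sums_diff[OF a b, of z z] that by (simp add: d_def algebra_simps)
  have d0: "d 0 = 0"
    using powser_limit_0_strong[of 1 d "\<lambda>_. 0"] d by (simp add: tendsto_const_iff)
  have d': "(\<lambda>n. d n * (z - 0) ^ n) sums 0" if "norm (z - 0) < 1" for z
  proof (cases "z = 0")
    case True
    show ?thesis using powser_sums_zero[of d] d0 True by simp
  next
    case False
    thus ?thesis using d[of z] that by simp
  qed
  have "d m = 0" for m
  proof (rule ccontr)
    assume m: "d m \<noteq> 0"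
    hence "m > 0" using d0 by (cases m) auto
    show False
    proof (rule powser_0_nonzero[of 1 0 d "\<lambda>_. 0" m])
      fix s :: real
      assume s: "0 < s" "\<And>z::complex. z \<in> cball 0 s - {0} \<Longrightarrow> (0::complex) \<noteq> 0"
      have "complex_of_real s \<in> cball 0 s - {0}" using s(1) by auto
      from s(2)[OF this] show False by simp
    qed (use d' m \<open>m > 0\<close> in auto)
  qed
  thus ?thesis by (auto simp: d_def fun_eq_iff)
qed

lemma gregory_expansion_exists:
  "\<exists>G :: nat \<Rightarrow> real. \<forall>z::complex. 0 < norm z \<and> norm z < 1 \<longrightarrow>
     (\<lambda>n. of_real (G n) * z ^ n) sums (z / Ln (1 + z))"
proof -
  define f :: "complex \<Rightarrow> complex" where "f z = (if z = 0 then 1 else z / Ln (1 + z))" for z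
  have nonpos: "1 + z \<notin> \<real>\<^sub>\<le>\<^sub>0" if "norm z < 1" for z :: complex
  proof
    assume "1 + z \<in> \<real>\<^sub>\<le>\<^sub>0"
    hence "Re z \<le> -1" by (auto simp: complex_nonpos_Reals_iff)
    with abs_Re_le_cmod[of z] that show False by linarith
  qed
  have nz: "Ln (1 + z) \<noteq> 0" if "norm z < 1" "z \<noteq> 0" for z :: complex
  proof
    assume "Ln (1 + z) = 0"
    moreover have "1 + z \<noteq> 0" using nonpos[OF that(1)] by auto
    ultimately have "1 + z = 1" by (metis exp_Ln exp_zero)
    with that show False by simp
  qed
  have "((\<lambda>z::complex. Ln (1 + z)) has_field_derivative 1) (at 0)"
    by (auto intro!: derivative_eq_intros)
  hence "((\<lambda>z::complex. Ln (1 + z) / z) \<longlongrightarrow> 1) (at 0)"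
    by (simp add: has_field_derivative_iff)
  from tendsto_inverse[OF this] have lim: "((\<lambda>z::complex. z / Ln (1 + z)) \<longlongrightarrow> 1) (at 0)"
    by (simp add: field_simps)
  have "f holomorphic_on ball 0 1"
  proof (rule no_isolated_singularity'[of "{0}"])
    show "(f \<longlongrightarrow> f z) (at z within ball 0 1)" if "z \<in> {0}" for z
    proof -
      have "(f \<longlongrightarrow> 1) (at 0)"
        using lim by (rule Lim_transform_eventually) (auto simp: f_def eventually_at_filter)
      thus ?thesis using that by (auto simp: f_def intro: tendsto_within_subset)
    qed
    have "(\<lambda>z. z / Ln (1 + z)) holomorphic_on (ball 0 1 - {0})"
      using nonpos nz by (intro holomorphic_intros) auto
    thus "f holomorphic_on (ball 0 1 - {0})"
      by (rule holomorphic_transform) (auto simp: f_def)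
  qed auto
  note series = holomorphic_power_series[OF this]
  define a where "a n = (deriv ^^ n) f 0 / fact n" for n
  have a0: "(\<lambda>n. a n * z ^ n) sums f z" if "norm z < 1" for z
    using series[of z] that by (simp add: a_def)
  have a: "(\<lambda>n. a n * z ^ n) sums (z / Ln (1 + z))" if "0 < norm z" "norm z < 1" for z
    using a0[of z] that by (auto simp: f_def)
  have "(\<lambda>n. cnj (a n) * z ^ n) sums (z / Ln (1 + z))" if "0 < norm z" "norm z < 1" for z
  proof -
    have "(\<lambda>n. cnj (a n * cnj z ^ n)) sums cnj (cnj z / Ln (1 + cnj z))"
      using a[of "cnj z"] that by (subst sums_cnj) auto
    moreover have "cnj (Ln (1 + cnj z)) = Ln (1 + z)"
      using cnj_Ln[of "1 + cnj z"] nonpos[of "cnj z"] that by simp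
    ultimately show ?thesis by simp
  qed
  hence "a = (\<lambda>n. cnj (a n))" using a by (intro powser_punctured_unique) auto
  hence "of_real (Re (a n)) = a n" for n
    by (metis complex_cnj_cancel_iff Reals_cnj_iff of_real_Re)
  thus ?thesis using a by (intro exI[of _ "\<lambda>n. Re (a n)"]) simp
qed

lemma gregory_coeff_eqI:
  fixes G :: "nat \<Rightarrow> real"
  assumes "\<And>z::complex. 0 < norm z \<Longrightarrow> norm z < 1 \<Longrightarrow>
             (\<lambda>n. of_real (G n) * z ^ n) sums (z / Ln (1 + z))"
  shows "gregory_coeff = G"
  unfolding gregory_coeff_def
proof (rule the_equality)
  fix H :: "nat \<Rightarrow> real"
  assume "\<forall>z::complex. 0 < norm z \<and> norm z < 1 \<longrightarrow>
     (\<lambda>n. of_real (H n) * z ^ n) sums (z / Ln (1 + z))"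
  hence "(\<lambda>n. complex_of_real (H n)) = (\<lambda>n. complex_of_real (G n))"
    using assms by (intro powser_punctured_unique) auto
  thus "H = G" by (auto simp: fun_eq_iff)
qed (use assms in auto)

lemma gregory_coeff_sums:
  fixes z :: complex
  assumes "0 < norm z" "norm z < 1"
  shows "(\<lambda>n. of_real (gregory_coeff n) * z ^ n) sums (z / Ln (1 + z))"
proof -
  obtain G :: "nat \<Rightarrow> real" where G: "\<And>z::complex. 0 < norm z \<Longrightarrow> norm z < 1 \<Longrightarrow>
      (\<lambda>n. of_real (G n) * z ^ n) sums (z / Ln (1 + z))"
    using gregory_expansion_exists by blast
  with gregory_coeff_eqI[OF G] assms show ?thesis by simp
qed

text \<open>
  \<open>\<Gamma>(x + 1) / (\<Gamma>(z + 1) \<Gamma>(x - z + 1))\<close>. The library's \<open>gchoose\<close> only allows a natural number as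
  lower argument. Using \<open>rGamma\<close>, the entire function \<open>1 / \<Gamma>\<close>, gives the value \<open>0\<close> at
  the poles of the Gamma functions in the denominator.
\<close>

definition complex_binomial :: "complex \<Rightarrow> complex \<Rightarrow> complex" where
  "complex_binomial x z = Gamma (x + 1) * rGamma (z + 1) * rGamma (x - z + 1)"

definition gregory_fun :: "complex \<Rightarrow> complex" where
  "gregory_fun z = integral {0..1} (\<lambda>x::real. complex_binomial (of_real x) z)"

lemma gregory_fun_altdef:
  "gregory_fun z = rGamma (z + 1) *
     integral {0..1} (\<lambda>x::real. Gamma (of_real x + 1) * rGamma (of_real x - z + 1))"
proof -
  have "gregory_fun z = integral {0..1} (\<lambda>x::real. rGamma (z + 1) *
          (Gamma (of_real x + 1) * rGamma (of_real x - z + 1)))"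
    unfolding gregory_fun_def complex_binomial_def by (simp add: mult_ac)
  thus ?thesis by simp
qed

text \<open>
  \<open>remove_sings\<close> replaces the value at each removable singularity, in particular at the
  nonpositive integers, by the limit there. Its value at a pole is the dummy \<open>0\<close>.
\<close>

definition gregory_transform :: "complex \<Rightarrow> complex" where
  "gregory_transform =
     remove_sings (\<lambda>z. of_real pi * z / sin (of_real pi * z) * gregory_fun z)"

end

theory Submission
  imports Defs
begin

text \<open>
  By reflection \<open>gregory_transform z\<close> is the integral over \<open>x \<in> {0..1}\<close> of
  \<open>\<Gamma>(x + 1) \<Gamma>(1 - z) / \<Gamma>(x - z + 1)\<close>, which for \<open>Re z < 1\<close> is \<open>x B(x, 1 - z)\<close>. Expanding
  \<open>(1 - t) powr (x - 1)\<close> binomially inside the Beta integral gives the partial fraction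
  expansion of the integrand, with coefficients \<open>n (-1)^(n-1) (x gchoose n)\<close>. These are nonnegative and
  \<open>(-1)^(n-1) (x gchoose n)\<close> has integral \<open>\<bar>G\<^sub>n\<bar>\<close>, so integration over \<open>x\<close> can be done termwise.
\<close>

section \<open>Sign-adjusted binomial coefficients on the unit interval\<close>

text \<open>Index \<open>n\<close> belongs to the pole at \<open>n + 1\<close>. The sign is chosen
  so that the value on \<open>{0..1}\<close> is the absolute value of
  \<open>x gchoose Suc n\<close>.\<close>

definition alt_binom :: "nat \<Rightarrow> real \<Rightarrow> real" where
  "alt_binom n x = (-1) ^ n * (x gchoose Suc n)"

text \<open>The numerator of a pole term is absorbed into the binomial coefficient. What remains is,
  up to the factor \<open>x\<close>, a coefficient of the binomial series of
  \<open>(1 - t) powr (x - 1)\<close>.\<close>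

lemma alt_binom_absorption:
  "real (Suc n) * alt_binom n x = x * ((-1) ^ n * (x - 1 gchoose n))"
proof -
  have "real (Suc n) * alt_binom n x = (-1) ^ n * (of_nat (Suc n) * (x gchoose Suc n))"
    by (simp only: alt_binom_def mult_ac)
  thus ?thesis by (simp only: gbinomial_absorption mult_ac)
qed

text \<open>The sign turns the falling factorial of \<open>x - 1\<close> into the rising factorial
  of \<open>1 - x\<close>, whose factors are all nonnegative.\<close>

lemma alternating_gbinomial_nonneg:
  fixes x :: real
  assumes "x \<le> 1"
  shows "0 \<le> (-1) ^ n * (x - 1 gchoose n)"
proof -
  have "(-1) ^ n * (x - 1 gchoose n) = pochhammer (1 - x) n / fact n"
    by (simp add: gbinomial_pochhammer flip: power_mult_distrib mult.assoc)
  also have "\<dots> \<ge> 0"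
    using assms by (auto simp: pochhammer_prod intro!: divide_nonneg_pos prod_nonneg)
  finally show ?thesis .
qed

lemma alt_binom_nonneg:
  assumes "0 \<le> x" "x \<le> 1"
  shows "0 \<le> alt_binom n x"
proof -
  have "0 \<le> real (Suc n) * alt_binom n x"
    unfolding alt_binom_absorption using assms alternating_gbinomial_nonneg[of x n] by simp
  thus ?thesis by (simp add: zero_le_mult_iff)
qed

text \<open>Alternating partial sums of a binomial row have a closed form, which is nonnegative
  here. The bound is uniform in \<open>x\<close> and \<open>N\<close>, and the summability and
  domination arguments below rest on it.\<close>

lemma sum_alt_binom_le_1:
  assumes "x \<le> 1"
  shows "(\<Sum>n<N. alt_binom n x) \<le> 1"
proof -
  \<comment> \<open>The term \<open>k = 0\<close> supplies the 1; the term \<open>k = Suc n\<close>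
    is \<open>- alt_binom n x\<close>.\<close>
  have "1 - (\<Sum>n<N. alt_binom n x) = (\<Sum>k\<le>N. (x gchoose k) * (-1) ^ k)"
    unfolding lessThan_Suc_atMost[symmetric]
    by (subst sum.lessThan_Suc_shift) (simp add: alt_binom_def sum_negf mult_ac)
  also have "\<dots> \<ge> 0"
    unfolding gbinomial_sum_lower_neg using alternating_gbinomial_nonneg[OF assms] .
  finally show ?thesis by simp
qed

lemma summable_alt_binom:
  assumes "0 \<le> x" "x \<le> 1"
  shows "summable (\<lambda>n. alt_binom n x)"
proof (rule bounded_imp_summable)
  show "(\<Sum>k\<le>n. alt_binom k x) \<le> 1" for n
    using sum_alt_binom_le_1[of x "Suc n"] assms by (simp add: lessThan_Suc_atMost)
qed (use alt_binom_nonneg assms in auto)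

lemma continuous_on_gbinomial: "continuous_on A (\<lambda>x::real. x gchoose n)"
  unfolding gbinomial_prod_rev by (intro continuous_intros) auto

lemma continuous_on_alt_binom: "continuous_on A (alt_binom n)"
  unfolding alt_binom_def[abs_def] by (intro continuous_intros continuous_on_gbinomial)

text \<open>For positive \<open>n\<close> this is a single term of a nonnegative sum bounded by 1.
  It lets a geometric series dominate the binomial series of \<open>(1 + z) powr x\<close>.\<close>

lemma abs_gbinomial_le_1:
  fixes x :: real
  assumes "0 \<le> x" "x \<le> 1"
  shows "\<bar>x gchoose n\<bar> \<le> 1"
proof (cases n)
  case (Suc m)
  have "\<bar>x gchoose n\<bar> = alt_binom m x"
    using abs_of_nonneg[OF alt_binom_nonneg[OF assms, of m]] by (simp add: alt_binom_def Suc abs_mult)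
  also have "\<dots> \<le> (\<Sum>n<Suc m. alt_binom n x)"
    using alt_binom_nonneg[OF assms] by (simp add: sum_nonneg)
  also have "\<dots> \<le> 1" using sum_alt_binom_le_1[OF assms(2)] .
  finally show ?thesis .
qed simp

section \<open>Gregory coefficients as integrals of binomial coefficients\<close>

text \<open>Integrating \<open>(1 + z) powr x = exp (x * L)\<close> over \<open>x\<close>, once in
  closed form and once termwise through its binomial series, gives the defining expansion.\<close>

lemma gregory_coeff_eq_integral:
  "gregory_coeff = (\<lambda>n. integral {0..1} (\<lambda>x. x gchoose n))"
proof (rule gregory_coeff_eqI)
  fix z :: complex
  assume z: "0 < norm z" "norm z < 1"
  define L where "L = Ln (1 + z)"
  have z1: "1 + z \<noteq> 0" using z(2) by (metis add_eq_0_iff norm_minus_cancel norm_one less_irrefl)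
  have expL: "exp L = 1 + z" unfolding L_def using z1 by simp
  have L0: "L \<noteq> 0" using expL z by auto
  define f :: "nat \<Rightarrow> real \<Rightarrow> complex" where
    "f N x = (\<Sum>n<N. of_real (x gchoose n) * z ^ n)" for N x
  have int: "(\<lambda>x. complex_of_real (x gchoose n) * z ^ n) integrable_on {0..1}" for n
    by (intro integrable_continuous_real continuous_intros continuous_on_gbinomial)
  have lim: "(\<lambda>N. f N x) \<longlonglongrightarrow> exp (of_real x * L)" for x
    using gen_binomial_complex[OF z(2), of "of_real x"] z1
    by (simp add: sums_def f_def powr_def L_def gbinomial_prod_rev)
  have bound: "norm (f N x) \<le> 1 / (1 - norm z)" if "x \<in> {0..1}" for N x
  proof -
    have "norm (f N x) \<le> (\<Sum>n<N. norm z ^ n)"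
      unfolding f_def using that abs_gbinomial_le_1[of x]
      by (intro sum_norm_le) (simp add: norm_mult norm_power mult_left_le_one_le)
    also have "\<dots> \<le> (\<Sum>n. norm z ^ n)"
      using z by (intro sum_le_suminf summable_geometric) auto
    also have "\<dots> = 1 / (1 - norm z)" using z by (intro suminf_geometric) auto
    finally show ?thesis .
  qed
  have "(\<lambda>N. integral {0..1} (f N)) \<longlonglongrightarrow> integral {0..1} (\<lambda>x::real. exp (of_real x * L))"
  proof (rule dominated_convergence(2))
    show "f N integrable_on {0..1}" for N
      unfolding f_def[abs_def] by (intro integrable_sum int) auto
  qed (use bound lim in \<open>auto intro!: integrable_const_ivl\<close>)
  \<comment> \<open>The value is \<open>(exp L - 1) / L = z / L\<close>, since
    \<open>exp L = 1 + z\<close>.\<close>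
  moreover have "((\<lambda>x::real. exp (of_real x * L)) has_integral
      (exp (of_real 1 * L) / L - exp (of_real 0 * L) / L)) {0..1}"
    using L0 by (intro fundamental_theorem_of_calculus)
      (auto intro!: derivative_eq_intros has_vector_derivative_real_field simp: field_simps)
  moreover have "integral {0..1} (f N) =
      (\<Sum>n<N. of_real (integral {0..1} (\<lambda>x. x gchoose n)) * z ^ n)" for N
  proof -
    have "integral {0..1} (f N) =
        (\<Sum>n<N. integral {0..1} (\<lambda>x. complex_of_real (x gchoose n) * z ^ n))"
      unfolding f_def[abs_def] using int by (intro integral_sum) auto
    also have "\<dots> = (\<Sum>n<N. of_real (integral {0..1} (\<lambda>x. x gchoose n)) * z ^ n)"
    proof (intro sum.cong refl)
      fix n
      have "(\<lambda>x. x gchoose n) integrable_on {0..1::real}"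
        by (intro integrable_continuous_real continuous_on_gbinomial)
      from has_integral_of_real[OF integrable_integral[OF this], where 'b = complex]
      show "integral {0..1} (\<lambda>x. complex_of_real (x gchoose n) * z ^ n) =
          of_real (integral {0..1} (\<lambda>x. x gchoose n)) * z ^ n"
        by (intro integral_unique has_integral_mult_left)
    qed
    finally show ?thesis .
  qed
  ultimately show
    "(\<lambda>n. of_real (integral {0..1} (\<lambda>x. x gchoose n)) * z ^ n) sums (z / Ln (1 + z))"
    using expL by (simp add: sums_def integral_unique L_def diff_divide_distrib[symmetric])
qed

text \<open>The integral is the Gregory coefficient up to sign, and it is nonnegative, so it equals
  the absolute value.\<close>

lemma has_integral_alt_binom:
  "(alt_binom n has_integral \<bar>gregory_coeff (Suc n)\<bar>) {0..1}"
proof -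
  have int: "alt_binom n integrable_on {0..1}"
    by (intro integrable_continuous_real continuous_on_alt_binom)
  have "integral {0..1} (alt_binom n) = (-1) ^ n * gregory_coeff (Suc n)"
    unfolding gregory_coeff_eq_integral alt_binom_def[abs_def] by simp
  hence "\<bar>integral {0..1} (alt_binom n)\<bar> = \<bar>gregory_coeff (Suc n)\<bar>"
    by (simp add: abs_mult)
  moreover have "0 \<le> integral {0..1} (alt_binom n)"
    using int by (rule integral_nonneg) (simp add: alt_binom_nonneg)
  ultimately have "integral {0..1} (alt_binom n) = \<bar>gregory_coeff (Suc n)\<bar>"
    by linarith
  with int show ?thesis by (simp add: has_integral_integrable_integral)
qed

text \<open>Integrating the pointwise bound of \<open>sum_alt_binom_le_1\<close> bounds the partial
  sums by 1.\<close>

lemma summable_abs_gregory_coeff: "summable (\<lambda>n. \<bar>gregory_coeff (Suc n)\<bar>)"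
proof (rule bounded_imp_summable)
  show "(\<Sum>k\<le>n. \<bar>gregory_coeff (Suc k)\<bar>) \<le> 1" for n
  proof (rule has_integral_le)
    show "((\<lambda>x. \<Sum>k\<le>n. alt_binom k x) has_integral (\<Sum>k\<le>n. \<bar>gregory_coeff (Suc k)\<bar>)) {0..1}"
      by (intro has_integral_sum has_integral_alt_binom) auto
    show "((\<lambda>_. 1::real) has_integral 1) {0..1::real}"
      using has_integral_const_real[of "1::real" 0 1] by simp
    show "(\<Sum>k\<le>n. alt_binom k x) \<le> 1" if "x \<in> {0..1}" for x
      using sum_alt_binom_le_1[of x "Suc n"] that by (simp add: lessThan_Suc_atMost)
  qed
qed auto

section \<open>Series of simple poles at the positive integers\<close>

abbreviation (input) pos_nats :: "complex set" where
  "pos_nats \<equiv> of_nat ` {1..}"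

lemma of_nat_Suc_in_pos_nats: "of_nat (Suc n) \<in> pos_nats"
  by (rule imageI) simp

lemma open_compl_pos_nats: "open (- pos_nats)"
proof -
  have "pos_nats \<subseteq> \<int>" by auto
  from closed_subset_Ints[OF this] show ?thesis by (simp add: open_Compl)
qed

lemma connected_compl_pos_nats: "connected (- pos_nats)"
  unfolding Compl_eq_Diff_UNIV by (rule connected_open_diff_countable) auto

text \<open>With \<open>k = Suc n\<close>, the inequality |k| \<le> |k - w| + |w| reduces the bound
  to one for |w| / |k - w|, whose numerator is bounded and whose denominator stays away from 0 on
  the ball.\<close>

lemma cball_avoiding_pos_nats:
  assumes "z \<notin> pos_nats"
  obtains e C where "e > 0" "cball z e \<subseteq> - pos_nats"
    "\<And>w n. w \<in> cball z e \<Longrightarrow> norm (of_nat (Suc n) / (of_nat (Suc n) - w)) \<le> C"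
proof -
  obtain d where d: "d > 0" "cball z d \<subseteq> - pos_nats"
    using open_compl_pos_nats assms by (meson ComplI open_contains_cball)
  \<comment> \<open>Halving the radius keeps every point of the smaller ball at distance more than
    \<open>e\<close> from all poles.\<close>
  define e where "e = d / 2"
  have e: "e > 0" "2 * e = d" using d by (auto simp: e_def)
  show thesis
  proof (rule that[of e "1 + (norm z + e) / e"])
    show "e > 0" by fact
    show "cball z e \<subseteq> - pos_nats" 
      using d(2) e subset_cball[of e d z] by force
    fix w n assume w: "w \<in> cball z e"
    define k where "k = complex_of_nat (Suc n)"
    have "k \<notin> cball z d" using d(2) of_nat_Suc_in_pos_nats[of n] unfolding k_def by blast
    hence "d < dist z k" by simp
    also have "\<dots> \<le> dist z w + dist w k" by (rule dist_triangle)
    finally have far: "e < norm (k - w)" using w e by (simp add: dist_norm norm_minus_commute)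
    have "norm w \<le> norm z + e"
      using w norm_triangle_ineq2[of w z] by (simp add: dist_norm norm_minus_commute)
    also have "\<dots> \<le> (norm z + e) / e * norm (k - w)"
    proof -
      have "(norm z + e) / e * e \<le> (norm z + e) / e * norm (k - w)"
        using far e(1) by (intro mult_left_mono) auto
      thus ?thesis using e(1) by simp
    qed
    finally have "norm k \<le> (1 + (norm z + e) / e) * norm (k - w)"
      using norm_triangle_ineq[of "k - w" w] by (simp add: algebra_simps)
    thus "norm (of_nat (Suc n) / (of_nat (Suc n) - w)) \<le> 1 + (norm z + e) / e"
      using far e(1) unfolding k_def[symmetric] norm_divide by (subst pos_divide_le_eq) auto
  qed
qed

text \<open>The coefficients are a parameter because the series is used both with
  \<open>alt_binom n x\<close> at fixed \<open>x\<close> and with the Gregory coefficients. At a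
  positive integer one term has the dummy value 0, so the lemmas stay off these points.\<close>

definition pole_series :: "(nat \<Rightarrow> real) \<Rightarrow> complex \<Rightarrow> complex" where
  "pole_series a z = (\<Sum>n. of_real (a n) * (of_nat (Suc n) / (of_nat (Suc n) - z)))"

text \<open>Weierstrass M-test, with the local bound on the pole factors as a constant multiple of
  the summable coefficients.\<close>

lemma pole_series_uniform_limit:
  assumes "summable (\<lambda>n. \<bar>a n\<bar>)" "z \<notin> pos_nats"
  shows "\<exists>e>0. cball z e \<subseteq> - pos_nats \<and>
    uniform_limit (cball z e)
      (\<lambda>N w. \<Sum>n<N. of_real (a n) * (of_nat (Suc n) / (of_nat (Suc n) - w))) (pole_series a) sequentially"
proof -
  obtain e C where e: "e > 0" "cball z e \<subseteq> - pos_nats"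
    and C: "\<And>w n. w \<in> cball z e \<Longrightarrow> norm (of_nat (Suc n) / (of_nat (Suc n) - w)) \<le> C"
    using cball_avoiding_pos_nats[OF assms(2)] by metis
  have "uniform_limit (cball z e)
      (\<lambda>N w. \<Sum>n<N. of_real (a n) * (of_nat (Suc n) / (of_nat (Suc n) - w))) (pole_series a) sequentially"
    unfolding pole_series_def[abs_def]
  proof (rule Weierstrass_m_test)
    show "summable (\<lambda>n. \<bar>a n\<bar> * C)" using assms(1) by (rule summable_mult2)
    show "norm (complex_of_real (a n) * (of_nat (Suc n) / (of_nat (Suc n) - w))) \<le> \<bar>a n\<bar> * C"
      if "w \<in> cball z e" for n w
      unfolding norm_mult norm_of_real using C[OF that] by (rule mult_left_mono) simp
  qed
  with e show ?thesis by blast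
qed

lemma pole_series_sums:
  assumes "summable (\<lambda>n. \<bar>a n\<bar>)" "z \<notin> pos_nats"
  shows "(\<lambda>n. of_real (a n) * (of_nat (Suc n) / (of_nat (Suc n) - z))) sums pole_series a z"
proof -
  obtain e where "e > 0" "uniform_limit (cball z e)
      (\<lambda>N w. \<Sum>n<N. of_real (a n) * (of_nat (Suc n) / (of_nat (Suc n) - w))) (pole_series a) sequentially"
    using pole_series_uniform_limit[OF assms] by blast
  thus ?thesis unfolding sums_def by (intro tendsto_uniform_limitI) auto
qed

lemma pole_series_holomorphic:
  assumes "summable (\<lambda>n. \<bar>a n\<bar>)"
  shows "pole_series a holomorphic_on - pos_nats"
proof (rule holomorphic_uniform_sequence[OF open_compl_pos_nats])
  show "(\<lambda>w. \<Sum>n<N. of_real (a n) * (of_nat (Suc n) / (of_nat (Suc n) - w)))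
      holomorphic_on - pos_nats" for N
    using of_nat_Suc_in_pos_nats by (intro holomorphic_intros) (metis ComplD eq_iff_diff_eq_0)
qed (use pole_series_uniform_limit[OF assms] in auto)

section \<open>Partial fractions of the integrand\<close>

text \<open>This is the case \<open>z = - s\<close> on the negative real axis. There the expanded
  Beta integrand has only nonnegative terms, so monotone convergence permits termwise
  integration.\<close>

lemma alt_binom_sums_Beta:
  assumes x: "0 < x" "x \<le> 1" and s: "0 < s"
  shows "(\<lambda>n. alt_binom n x * (real (Suc n) / (real (Suc n) + s))) sums (x * Beta (1 + s) x)"
proof -
  define c where "c n = real (Suc n) * alt_binom n x" for n
  have c: "c n \<ge> 0" for n using alt_binom_nonneg[of x n] x by (simp add: c_def)
  define F where "F N t = (\<Sum>n<N. c n * t powr (real n + s))" for N t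
  define X where "X N = (\<Sum>n<N. c n / (real (Suc n) + s))" for N
  have sm: "summable (\<lambda>n. c n / (real (Suc n) + s))"
  \<comment> \<open>The factor \<open>Suc n / (Suc n + s)\<close> is at most 1.\<close>
  proof (rule summable_comparison_test')
    show "summable (\<lambda>n. alt_binom n x)" using summable_alt_binom x by simp
    show "norm (c n / (real (Suc n) + s)) \<le> alt_binom n x" for n
      using c[of n] alt_binom_nonneg[of x n] s x by (simp add: c_def field_simps)
  qed
  \<comment> \<open>On the open interval |t| < 1, so the binomial series applies, and t > 0, so
    \<open>t powr real n\<close> is an ordinary power.\<close>
  have "((\<lambda>t. t powr s * (x * (1 - t) powr (x - 1))) has_integral
      (\<Sum>n. c n / (real (Suc n) + s))) {0<..<1}"
  proof (rule has_integral_monotone_convergence_increasing)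
    show "(F N has_integral X N) {0<..<1}" for N
    proof -
      have "((\<lambda>t. t powr (real n + s)) has_integral 1 / (real (Suc n) + s)) {0..1}" for n
        using has_integral_powr_from_0[of "real n + s" 1] s by (simp add: add_ac)
      hence "((\<lambda>t. c n * t powr (real n + s)) has_integral c n * (1 / (real (Suc n) + s))) {0..1}"
        for n by (rule has_integral_mult_right)
      hence "(F N has_integral X N) {0..1}"
        unfolding F_def[abs_def] X_def by (intro has_integral_sum) auto
      thus ?thesis by (simp only: has_integral_Icc_iff_Ioo)
    qed
    show "F N t \<le> F (Suc N) t" for N t unfolding F_def using c by simp
    show "(\<lambda>N. F N t) \<longlonglongrightarrow> t powr s * (x * (1 - t) powr (x - 1))" if t: "t \<in> {0<..<1}" for t
    proof -
      have "(\<lambda>n. t powr s * (x * ((x - 1 gchoose n) * (- t) ^ n)))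
          sums (t powr s * (x * (1 + - t) powr (x - 1)))"
        using t by (intro sums_mult gen_binomial_real) auto
      moreover have "t powr s * (x * ((x - 1 gchoose n) * (- t) ^ n)) = c n * t powr (real n + s)"
        for n
        using t unfolding c_def alt_binom_absorption
        by (simp add: powr_add powr_realpow power_minus[of t] mult_ac)
      ultimately show ?thesis by (simp add: sums_def F_def)
    qed
    show "X \<longlonglongrightarrow> (\<Sum>n. c n / (real (Suc n) + s))"
      using summable_LIMSEQ[OF sm] by (simp add: X_def[abs_def])
  qed
  moreover have "((\<lambda>t. t powr s * (x * (1 - t) powr (x - 1))) has_integral
      x * Beta (1 + s) x) {0<..<1}"
    using has_integral_mult_right[OF has_integral_Beta_real[of "1 + s" x], of x] s x
    by (simp add: has_integral_Icc_iff_Ioo mult_ac)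
  ultimately have "(\<Sum>n. c n / (real (Suc n) + s)) = x * Beta (1 + s) x"
    by (rule has_integral_unique)
  with summable_sums[OF sm] show ?thesis by (simp add: c_def mult_ac)
qed

text \<open>Both sides are holomorphic off the positive integers and agree on the negative real axis
  by the Beta series; the identity theorem extends this to the whole connected domain.\<close>

lemma pole_series_alt_binom:
  assumes x: "0 < x" "x \<le> 1" and z: "z \<notin> pos_nats"
  shows "pole_series (\<lambda>n. alt_binom n x) z =
    Gamma (1 - z) * (Gamma (of_real x + 1) * rGamma (of_real x - z + 1))"
proof -
  define h :: "complex \<Rightarrow> complex" where
    "h w = Gamma (1 - w) * (Gamma (of_real x + 1) * rGamma (of_real x - w + 1))" for w
  have abs: "summable (\<lambda>n. \<bar>alt_binom n x\<bar>)"
    using summable_alt_binom[of x] alt_binom_nonneg[of x] x by simp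
  have nonpos: "1 - w \<notin> \<int>\<^sub>\<le>\<^sub>0" if "w \<in> - pos_nats" for w
  proof
    assume "1 - w \<in> \<int>\<^sub>\<le>\<^sub>0"
    then obtain n where "1 - w = - of_nat n" by (elim nonpos_Ints_cases')
    hence "w = of_nat (Suc n)" by (simp add: algebra_simps)
    with that of_nat_Suc_in_pos_nats[of n] show False by auto
  qed
  define V where "V = (\<lambda>s. complex_of_real (- s)) ` {0<..}"
  have agree: "pole_series (\<lambda>n. alt_binom n x) w - h w = 0" if "w \<in> V" "w \<notin> pos_nats" for w
  proof -
    from that obtain s where s: "s > 0" "w = - of_real s" by (auto simp: V_def)
    have "(\<lambda>n. complex_of_real (alt_binom n x * (real (Suc n) / (real (Suc n) + s))))
        sums of_real (x * Beta (1 + s) x)"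
      using alt_binom_sums_Beta[OF x s(1)] by (rule sums_of_real)
    moreover have "(\<lambda>n. complex_of_real (alt_binom n x * (real (Suc n) / (real (Suc n) + s))))
        sums pole_series (\<lambda>n. alt_binom n x) w"
      using pole_series_sums[OF abs that(2)] s by simp
    ultimately have "pole_series (\<lambda>n. alt_binom n x) w = of_real (x * Beta (1 + s) x)"
      by (rule sums_unique2[symmetric])
    \<comment> \<open>Here \<open>x * Gamma x = Gamma (x + 1)\<close> absorbs the factor
      \<open>x\<close>.\<close>
    also have "x * Beta (1 + s) x = Gamma (1 + s) * (Gamma (x + 1) * rGamma (x + s + 1))"
      using x by (subst Gamma_plus1) (auto simp: Beta_def rGamma_inverse_Gamma divide_inverse mult_ac add_ac)
    also have "complex_of_real \<dots> = h w"
      unfolding h_def s(2) by (simp flip: Gamma_complex_of_real rGamma_complex_of_real)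
    finally show ?thesis by simp
  qed
  have negV: "V \<subseteq> - pos_nats"
  proof
    fix w assume "w \<in> V"
    hence "Re w < 0" by (auto simp: V_def)
    thus "w \<in> - pos_nats" by auto
  qed
  have "-1 islimpt V"
    unfolding islimpt_approachable
  proof (intro allI impI)
    fix e :: real assume e: "e > 0"
    define u where "u = complex_of_real (- (1 + e / 2))"
    have "u \<in> V" unfolding V_def u_def
      by (rule image_eqI[where x = "1 + e / 2"]) (use e in auto)
    moreover have "u - (- 1) = complex_of_real (- (e / 2))" by (simp add: u_def)
    hence "dist u (- 1) = e / 2" using e by (simp only: dist_norm norm_of_real)
    ultimately show "\<exists>w\<in>V. w \<noteq> - 1 \<and> dist w (- 1) < e"
      using e by (intro bexI[of _ u]) auto
  qed
  have "pole_series (\<lambda>n. alt_binom n x) z - h z = 0"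
  proof (rule analytic_continuation[where U = V and \<xi> = "-1" and
        f = "\<lambda>w. pole_series (\<lambda>n. alt_binom n x) w - h w"])
    show "(\<lambda>w. pole_series (\<lambda>n. alt_binom n x) w - h w) holomorphic_on - pos_nats"
      unfolding h_def using nonpos by (intro holomorphic_intros pole_series_holomorphic abs) auto
    have "(-1::complex) = of_real (- 1)" by simp
    hence "(-1::complex) \<in> V" unfolding V_def by (intro image_eqI[of _ _ 1]) auto
    with negV show "(-1::complex) \<in> - pos_nats" by blast
  qed (use open_compl_pos_nats connected_compl_pos_nats negV agree z \<open>-1 islimpt V\<close> in auto)
  thus ?thesis by (simp add: h_def)
qed

section \<open>Integration over \<open>x\<close> and removal of the singularities\<close>

text \<open>The partial fractions are integrated over \<open>x\<close> by dominated convergence, and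
  reflection rewrites the factor \<open>Gamma (1 - z)\<close>. Off the integers neither the sine nor
  the Gamma function causes trouble.\<close>

lemma pole_series_gregory:
  assumes "z \<notin> \<int>"
  shows "pole_series (\<lambda>n. \<bar>gregory_coeff (Suc n)\<bar>) z =
    of_real pi * z / sin (of_real pi * z) * gregory_fun z"
proof -
  have z: "z \<notin> pos_nats" using assms by auto
  define q where "q n = of_nat (Suc n) / (of_nat (Suc n) - z)" for n
  obtain C where C: "\<And>n. norm (q n) \<le> C"
    using cball_avoiding_pos_nats[OF z] unfolding q_def by (metis centre_in_cball less_imp_le)
  define h where "h x = Gamma (of_real x + 1) * rGamma (of_real x - z + 1)" for x :: real
  \<comment> \<open>The open interval excludes \<open>x = 0\<close>, which
    \<open>pole_series_alt_binom\<close> does not cover.\<close>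
  have hasint: "((\<lambda>x. \<Sum>n<N. of_real (alt_binom n x) * q n) has_integral
      (\<Sum>n<N. of_real \<bar>gregory_coeff (Suc n)\<bar> * q n)) {0<..<1}" for N
    unfolding has_integral_Icc_iff_Ioo[symmetric]
    by (intro has_integral_sum has_integral_mult_left has_integral_of_real has_integral_alt_binom) auto
  have "(\<lambda>N. integral {0<..<1} (\<lambda>x. \<Sum>n<N. of_real (alt_binom n x) * q n)) \<longlonglongrightarrow>
      integral {0<..<1} (\<lambda>x. Gamma (1 - z) * h x)"
  proof (rule dominated_convergence(2))
    show "(\<lambda>x. \<Sum>n<N. of_real (alt_binom n x) * q n) integrable_on {0<..<1}" for N
      using hasint by (rule has_integral_integrable)
    show "(\<lambda>_. C) integrable_on {0<..<1::real}"
      unfolding integrable_on_Icc_iff_Ioo[symmetric] by (rule integrable_const_ivl)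
    fix x :: real assume x: "x \<in> {0<..<1}"
    show "norm (\<Sum>n<N. of_real (alt_binom n x) * q n) \<le> C" for N
    proof -
      \<comment> \<open>The pole factors are bounded by \<open>C\<close> and the nonnegative weights
        \<open>alt_binom n x\<close> sum to at most 1, so \<open>C\<close> dominates.\<close>
      have "norm (\<Sum>n<N. of_real (alt_binom n x) * q n) \<le> (\<Sum>n<N. alt_binom n x * C)"
        using x C alt_binom_nonneg[of x]
        by (intro sum_norm_le) (auto simp: norm_mult intro!: mult_mono)
      also have "\<dots> = (\<Sum>n<N. alt_binom n x) * C" by (rule sum_distrib_right[symmetric])
      also have "\<dots> \<le> 1 * C"
        using x sum_alt_binom_le_1[of x N] order_trans[OF norm_ge_zero C]
        by (intro mult_right_mono) auto
      finally show ?thesis by simp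
    qed
    show "(\<lambda>N. \<Sum>n<N. of_real (alt_binom n x) * q n) \<longlonglongrightarrow> Gamma (1 - z) * h x"
      using pole_series_sums[of "\<lambda>n. alt_binom n x" z] pole_series_alt_binom[of x z] x z
        summable_alt_binom[of x] alt_binom_nonneg[of x]
      by (simp add: sums_def q_def h_def)
  qed
  hence "(\<lambda>n. of_real \<bar>gregory_coeff (Suc n)\<bar> * q n) sums (Gamma (1 - z) * integral {0<..<1} h)"
    using integral_unique[OF hasint] by (simp add: sums_def)
  moreover have "(\<lambda>n. of_real \<bar>gregory_coeff (Suc n)\<bar> * q n) sums
      pole_series (\<lambda>n. \<bar>gregory_coeff (Suc n)\<bar>) z"
    unfolding q_def using summable_abs_gregory_coeff z by (intro pole_series_sums) auto
  ultimately have "pole_series (\<lambda>n. \<bar>gregory_coeff (Suc n)\<bar>) z =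
      Gamma (1 - z) * integral {0<..<1} h"
    by (rule sums_unique2[symmetric])
  also have "integral {0<..<1} h = integral {0..1} h"
    by (simp add: integral_open_interval_real)
  \<comment> \<open>Reflection \<open>Gamma z * Gamma (1 - z) = pi / sin (pi * z)\<close>, with
    \<open>1 / Gamma z\<close> written as \<open>z * rGamma (z + 1)\<close>.\<close>
  also have "Gamma (1 - z) = of_real pi * z / sin (of_real pi * z) * rGamma (z + 1)"
  proof -
    have "Gamma z \<noteq> 0" using assms by (auto simp: Gamma_eq_zero_iff)
    moreover have "z * rGamma (z + 1) = inverse (Gamma z)"
      unfolding rGamma_plus1 by (rule rGamma_inverse_Gamma)
    moreover have "of_real pi * z / sin (of_real pi * z) * rGamma (z + 1) =
        of_real pi / sin (of_real pi * z) * (z * rGamma (z + 1))"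
      by simp
    ultimately show ?thesis
      by (simp flip: Gamma_reflection_complex)
  qed
  finally show ?thesis by (simp add: gregory_fun_altdef h_def[abs_def] mult_ac)
qed

text \<open>\<open>remove_sings\<close> takes the limit at \<open>z\<close>. Near \<open>z\<close>
  the quotient agrees with the series, which is continuous there, so the limit is the value of the
  series even when \<open>z\<close> is a nonpositive integer.\<close>

lemma gregory_transform_eq_pole_series:
  assumes "z \<notin> pos_nats"
  shows "gregory_transform z = pole_series (\<lambda>n. \<bar>gregory_coeff (Suc n)\<bar>) z"
  unfolding gregory_transform_def
proof (rule remove_sings_eqI)
  let ?S = "pole_series (\<lambda>n. \<bar>gregory_coeff (Suc n)\<bar>)"
  have "continuous_on (- pos_nats) ?S"
    by (intro holomorphic_on_imp_continuous_on pole_series_holomorphic)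
      (simp add: summable_abs_gregory_coeff)
  hence "?S \<midarrow>z\<rightarrow> ?S z"
    using assms open_compl_pos_nats by (auto simp: continuous_on_eq_continuous_at isCont_def)
  moreover have "\<forall>\<^sub>F w in at z. w \<notin> \<int>"
  proof -
    \<comment> \<open>Every set of integers is closed, so this is a neighbourhood of
      \<open>z\<close> whose other points are not integers.\<close>
    have "open (- (\<int> - {z}))"
      by (intro open_Compl closed_subset_Ints) auto
    from eventually_at_in_open[OF this, of z] show ?thesis by (auto elim!: eventually_mono)
  qed
  hence "\<forall>\<^sub>F w in at z. ?S w = of_real pi * w / sin (of_real pi * w) * gregory_fun w"
    by eventually_elim (rule pole_series_gregory)
  ultimately show "(\<lambda>w. of_real pi * w / sin (of_real pi * w) * gregory_fun w) \<midarrow>z\<rightarrow> ?S z"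
    by (rule Lim_transform_eventually)
qed

theorem theorem2p2:
  shows "(\<forall>z::complex. z \<notin> of_nat ` {1..} \<longrightarrow>
            (\<lambda>n. of_nat (Suc n) * of_real \<bar>gregory_coeff (Suc n)\<bar> / (of_nat (Suc n) - z))
              sums gregory_transform z \<and>
            (\<lambda>n. of_real \<bar>gregory_coeff (Suc n)\<bar> / (1 - z / of_nat (Suc n)))
              sums gregory_transform z) \<and>
         (\<forall>z::complex. z \<notin> of_nat ` {1..} \<longrightarrow>
            (\<exists>e>0. cball z e \<subseteq> - (of_nat ` {1..}) \<and>
               uniform_limit (cball z e)
                 (\<lambda>N w. \<Sum>n=1..N. of_nat n * of_real \<bar>gregory_coeff n\<bar> / (of_nat n - w))
                 gregory_transform sequentially))"
proof (intro conjI allI impI)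
  let ?g = "\<lambda>n. \<bar>gregory_coeff (Suc n)\<bar>"
  fix z :: complex
  assume z: "z \<notin> pos_nats"
  have abs: "summable (\<lambda>n. \<bar>?g n\<bar>)" by (simp add: summable_abs_gregory_coeff)
  have sums: "(\<lambda>n. of_real (?g n) * (of_nat (Suc n) / (of_nat (Suc n) - z))) sums gregory_transform z"
    using pole_series_sums[OF abs z] gregory_transform_eq_pole_series[OF z] by simp
  thus "(\<lambda>n. of_nat (Suc n) * of_real \<bar>gregory_coeff (Suc n)\<bar> / (of_nat (Suc n) - z))
      sums gregory_transform z"
    by (simp add: mult_ac)
  have "1 - z / of_nat (Suc n) = (of_nat (Suc n) - z) / of_nat (Suc n)" for n
    by (simp add: diff_divide_distrib del: of_nat_Suc)
  with sums show "(\<lambda>n. of_real \<bar>gregory_coeff (Suc n)\<bar> / (1 - z / of_nat (Suc n)))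
      sums gregory_transform z"
    by simp
  obtain e where e: "e > 0" "cball z e \<subseteq> - pos_nats" and
    lim: "uniform_limit (cball z e)
      (\<lambda>N w. \<Sum>n<N. of_real (?g n) * (of_nat (Suc n) / (of_nat (Suc n) - w))) (pole_series ?g) sequentially"
    using pole_series_uniform_limit[OF abs z] by blast
  have "uniform_limit (cball z e)
      (\<lambda>N w. \<Sum>n=1..N. of_nat n * of_real \<bar>gregory_coeff n\<bar> / (of_nat n - w))
      gregory_transform sequentially"
    using lim
  proof (rule uniform_limit_cong'[THEN iffD1, rotated 2])
    show "pole_series ?g w = gregory_transform w" if "w \<in> cball z e" for w
      using gregory_transform_eq_pole_series[of w] that e by auto
  \<comment> \<open>Reindexing from \<open>n = 1..N\<close> to \<open>Suc n\<close> with
    \<open>n < N\<close> matches the partial sums of \<open>pole_series\<close>.\<close>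
  qed (simp add: sum.atLeast1_atMost_eq mult_ac)
  with e show "\<exists>e>0. cball z e \<subseteq> - pos_nats \<and> uniform_limit (cball z e)
      (\<lambda>N w. \<Sum>n=1..N. of_nat n * of_real \<bar>gregory_coeff n\<bar> / (of_nat n - w))
      gregory_transform sequentially"
    by blast
qed

end
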